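(* Let $T>0$, $K>0$. For every fixed $u_0\in C([-1,0])$, the mapping $$\mathfrak m_T\ni\mu\mapsto z(\cdot;\mu,u_0)|_{[0,T]}\in AC([0,T])$$ is sequentially continuous. If, in addition, $u_0\in AC([-1,0])$, then the mapping $\mathfrak m_T\ni\mu\mapsto z(\cdot;\mu,u_0)\in AC([-1,T])$ is sequentially continuous.
   Context: Let $\mathfrak m$ be the set of finite signed Borel measures $\nu$ on $[-1,0]$ with $\|\nu\|_{\mathrm{TV}}\le K$. $\mathfrak m_T$ is the set of all maps $\mu:[0,T]\to\mathfrak m$, $t\mapsto\mu_t$, such that for every $f\in C([-1,0])$ the function $t\mapsto\int_{[-1,0]}f\,d\mu_t$ is Lebesgue measurable on $[0,T]$. Convergence of a sequence $\mu^{(n)}\to\mu$ in $\mathfrak m_T$ means: for Lebesgue-almost every $t\in[0,T]$, $\int f\,d\mu^{(n)}_t\to\int f\,d\mu_t$ for every $f\in C([-1,0])$; sequential continuity means that such convergence implies norm convergence of the images. For a compact interval $[a,b]$, $AC([a,b])$ is the space of real absolutely continuous functions with norm $\|u\|_{AC([a,b])}=|u(a)|+\int_a^b|u'(t)|\,dt$. For $\mu\in\mathfrak m_T$, $u_0\in C([-1,0])$, $z(\cdot;\mu,u_0)\in C([-1,T])$ denotes the unique continuous function with $z=u_0$ on $[-1,0]$ and $z(t)=u_0(0)+\int_0^t\int_{[-1,0]}z(\tau+s)\,d\mu_\tau(s)\,d\tau$ for $t\in[0,T]$; it is absolutely continuous on $[0,T]$. *)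

theory Defs
  imports "HOL-Analysis.Analysis"
begin

section \<open>Finite signed measures\<close>

text \<open>
  A finite signed measure on the measurable space \<open>M\<close> (whose own measure plays no role) is a
  countably additive real-valued set function. As for \<^const>\<open>emeasure\<close>, the value on
  non-measurable sets is 0 by convention.
\<close>

definition signed_measure :: "'a measure \<Rightarrow> ('a set \<Rightarrow> real) \<Rightarrow> bool" where
  "signed_measure M \<nu> \<longleftrightarrow>
     (\<forall>A :: nat \<Rightarrow> 'a set. range A \<subseteq> sets M \<longrightarrow> disjoint_family A \<longrightarrow>
        (\<lambda>i. \<nu> (A i)) sums \<nu> (\<Union>i. A i)) \<and>
     (\<forall>A. A \<notin> sets M \<longrightarrow> \<nu> A = 0)"

definition tv_norm :: "'a measure \<Rightarrow> ('a set \<Rightarrow> real) \<Rightarrow> ennreal" where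
  "tv_norm M \<nu> =
     (SUP P \<in> {P. finite P \<and> P \<subseteq> sets M \<and> partition_on (space M) P}. \<Sum>A\<in>P. ennreal \<bar>\<nu> A\<bar>)"

text \<open>
  The positive part of the Jordan decomposition,
  \<open>\<nu>\<^sup>+ A = sup {\<nu> B | B \<subseteq> A measurable}\<close>; the negative part is the positive part of \<open>- \<nu>\<close>.
  The function \<^const>\<open>ennreal\<close> sends negative values to 0, which does not change the supremum
  since \<open>B = {}\<close> is admitted.
\<close>

definition pos_part :: "'a measure \<Rightarrow> ('a set \<Rightarrow> real) \<Rightarrow> 'a measure" where
  "pos_part M \<nu> =
     measure_of (space M) (sets M) (\<lambda>A. SUP B \<in> {B \<in> sets M. B \<subseteq> A}. ennreal (\<nu> B))"

definition neg_part :: "'a measure \<Rightarrow> ('a set \<Rightarrow> real) \<Rightarrow> 'a measure" where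
  "neg_part M \<nu> = pos_part M (\<lambda>A. - \<nu> A)"

definition signed_integral :: "'a measure \<Rightarrow> ('a set \<Rightarrow> real) \<Rightarrow> ('a \<Rightarrow> real) \<Rightarrow> real" where
  "signed_integral M \<nu> f = (LINT s|pos_part M \<nu>. f s) - (LINT s|neg_part M \<nu>. f s)"


section \<open>The spaces of delay measures\<close>

abbreviation delay_space :: "real measure" where
  "delay_space \<equiv> restrict_space borel {-1..0}"

definition meas_ball :: "real \<Rightarrow> (real set \<Rightarrow> real) set" where
  "meas_ball K = {\<nu>. signed_measure delay_space \<nu> \<and> tv_norm delay_space \<nu> \<le> ennreal K}"

definition meas_paths :: "real \<Rightarrow> real \<Rightarrow> (real \<Rightarrow> real set \<Rightarrow> real) set" where
  "meas_paths K T =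
     {\<mu>. (\<forall>t\<in>{0..T}. \<mu> t \<in> meas_ball K) \<and>
         (\<forall>f. continuous_on {-1..0} f \<longrightarrow>
            (\<lambda>t. signed_integral delay_space (\<mu> t) f) \<in> borel_measurable (lebesgue_on {0..T}))}"

definition meas_paths_tendsto ::
  "real \<Rightarrow> (nat \<Rightarrow> real \<Rightarrow> real set \<Rightarrow> real) \<Rightarrow> (real \<Rightarrow> real set \<Rightarrow> real) \<Rightarrow> bool" where
  "meas_paths_tendsto T \<mu>s \<mu> \<longleftrightarrow>
     (AE t in lebesgue_on {0..T}. \<forall>f. continuous_on {-1..0} f \<longrightarrow>
        (\<lambda>n. signed_integral delay_space (\<mu>s n t) f)
          \<longlonglongrightarrow> signed_integral delay_space (\<mu> t) f)"


section \<open>Absolutely continuous functions\<close>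

definition AC :: "real \<Rightarrow> real \<Rightarrow> (real \<Rightarrow> real) set" where
  "AC a b = {u. \<forall>\<epsilon>>0. \<exists>\<delta>>0. \<forall>(n::nat) (x::nat \<Rightarrow> real) (y::nat \<Rightarrow> real).
      (\<forall>i<n. a \<le> x i \<and> x i \<le> y i \<and> y i \<le> b) \<longrightarrow>
      disjoint_family_on (\<lambda>i. {x i<..<y i}) {..<n} \<longrightarrow>
      (\<Sum>i<n. y i - x i) < \<delta> \<longrightarrow>
      (\<Sum>i<n. \<bar>u (y i) - u (x i)\<bar>) < \<epsilon>}"

text \<open>
  The derivative of an absolutely continuous function exists only almost everywhere; the
  integral runs over the interior points where it exists (elsewhere \<^const>\<open>deriv\<close> is
  unspecified). Only the values of \<open>u\<close> on \<open>{a..b}\<close> matter.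
\<close>

definition AC_norm :: "real \<Rightarrow> real \<Rightarrow> (real \<Rightarrow> real) \<Rightarrow> real" where
  "AC_norm a b u =
     \<bar>u a\<bar> + (LINT t:{t \<in> {a<..<b}. u differentiable at t}|lebesgue. \<bar>deriv u t\<bar>)"


section \<open>The delay equation\<close>

definition is_solution ::
  "real \<Rightarrow> (real \<Rightarrow> real set \<Rightarrow> real) \<Rightarrow> (real \<Rightarrow> real) \<Rightarrow> (real \<Rightarrow> real) \<Rightarrow> bool" where
  "is_solution T \<mu> u0 z \<longleftrightarrow>
     continuous_on {-1..T} z \<and>
     (\<forall>t\<in>{-1..0}. z t = u0 t) \<and>
     (\<forall>t\<in>{0..T}. z t = u0 0 +
        (LINT \<tau>:{0..t}|lebesgue. signed_integral delay_space (\<mu> \<tau>) (\<lambda>s. z (\<tau> + s))))"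

text \<open>Functions on \<open>{-1..T}\<close> are represented as elements of \<open>extensional {-1..T}\<close>, which
  makes the solution unique as a function on the reals.\<close>

definition sol ::
  "real \<Rightarrow> (real \<Rightarrow> real set \<Rightarrow> real) \<Rightarrow> (real \<Rightarrow> real) \<Rightarrow> real \<Rightarrow> real" where
  "sol T \<mu> u0 = (THE z. z \<in> extensional {-1..T} \<and> is_solution T \<mu> u0 z)"

text \<open>\<open>F\<close> maps \<open>meas_paths K T\<close> into \<open>AC a b\<close> and is sequentially continuous.\<close>

definition seq_continuous_into_AC ::
  "real \<Rightarrow> real \<Rightarrow> real \<Rightarrow> real \<Rightarrow> ((real \<Rightarrow> real set \<Rightarrow> real) \<Rightarrow> real \<Rightarrow> real) \<Rightarrow> bool" where
  "seq_continuous_into_AC K T a b F \<longleftrightarrow>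
     (\<forall>\<mu>\<in>meas_paths K T. F \<mu> \<in> AC a b) \<and>
     (\<forall>\<mu>s \<mu>. (\<forall>n. \<mu>s n \<in> meas_paths K T) \<longrightarrow> \<mu> \<in> meas_paths K T \<longrightarrow>
        meas_paths_tendsto T \<mu>s \<mu> \<longrightarrow>
        (\<lambda>n. AC_norm a b (\<lambda>t. F (\<mu>s n) t - F \<mu> t)) \<longlonglongrightarrow> 0)"

end

theory Submission
  imports Defs
begin

text \<open>
  A path \<open>\<mu>\<close> of measures acts on the equation only through the functionals
  \<open>L t f = \<integral> f d\<mu>\<^sub>t\<close>, and three properties of them are used: they are linear, they satisfy
  \<open>\<bar>L t f\<bar> \<le> M sup \<bar>f\<bar>\<close> with one constant \<open>M\<close> for all \<open>t\<close>, and \<open>t \<mapsto> L t f\<close> is measurable. The locale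
  \<open>delay_functional\<close> records them. They make \<open>t \<mapsto> L t (z (t + \<cdot>))\<close> bounded and measurable for
  continuous \<open>z\<close>, since \<open>t \<mapsto> z (t + \<cdot>)\<close> is a uniform limit of step functions on \<open>[0, T]\<close>.

  All estimates for the equation come from one inequality, \<open>delay_rate_integral_weighted\<close>: in the
  norm \<open>sup e\<^sup>-\<^sup>2\<^sup>M\<^sup>r \<bar>z r\<bar>\<close> the operator \<open>z \<mapsto> \<integral>\<^sub>0\<^sup>t L \<tau> (z (\<tau> + \<cdot>)) d\<tau>\<close> has norm at most \<open>1/2\<close>.
  Banach's theorem then gives the solution, and absorbing half of the norm on the left (in place
  of Gronwall's inequality) gives uniqueness and a perturbation bound.

  Let now \<open>z\<close> and \<open>z'\<close> solve the equations of \<open>L\<close> and \<open>L'\<close> with the same initial history. The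
  difference \<open>d = z' - z\<close> solves the equation of \<open>L'\<close> with zero history, up to the perturbation
  \<open>\<integral>\<^sub>0\<^sup>t (L' \<tau> - L \<tau>) (z (\<tau> + \<cdot>)) d\<tau>\<close>, which is at most
  \<open>\<epsilon> = \<integral>\<^sub>0\<^sup>T \<bar>(L' \<tau> - L \<tau>) (z (\<tau> + \<cdot>))\<bar> d\<tau>\<close>. Hence \<open>d\<close> is uniformly of order \<open>\<epsilon>\<close>, and so is
  \<open>\<integral> \<bar>d'\<bar>\<close>, because \<open>d' = L' t (d (t + \<cdot>)) + (L' t - L t) (z (t + \<cdot>))\<close> at almost every \<open>t\<close>; this is
  \<open>solution_difference_bounds\<close>. The function \<open>z\<close> in \<open>\<epsilon>\<close> is the limit solution, which does not
  depend on the index of the sequence, so that weak convergence at almost every \<open>\<tau>\<close> and dominated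
  convergence give \<open>\<epsilon> \<rightarrow> 0\<close>.

  On \<open>[-1, 0]\<close> the two solutions agree, so the norms on \<open>[0, T]\<close> and on \<open>[-1, T]\<close> are treated
  together. The derivative enters only through an upper bound for \<open>\<integral> \<bar>d'\<bar>\<close>, which
  \<open>AC_norm_le\<close> obtains from difference quotients and Fatou's lemma.
\<close>

section \<open>Integration against a signed measure\<close>

lemma signed_measure_empty:
  assumes "signed_measure M \<nu>"
  shows "\<nu> {} = 0"
proof -
  have "range (\<lambda>i::nat. {}) \<subseteq> sets M" "disjoint_family (\<lambda>i::nat. {} :: 'a set)"
    by (auto simp: disjoint_family_on_def)
  then have "(\<lambda>i::nat. \<nu> {}) sums \<nu> (\<Union>i::nat. {})"
    using assms unfolding signed_measure_def by blast
  then have "summable (\<lambda>i::nat. \<nu> {})"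
    by (rule sums_summable)
  then show ?thesis
    by (simp add: summable_const_iff)
qed

lemma signed_measure_Un:
  assumes "signed_measure M \<nu>" "A \<in> sets M" "B \<in> sets M" "A \<inter> B = {}"
  shows "\<nu> (A \<union> B) = \<nu> A + \<nu> B"
proof -
  have "disjoint_family (binaryset A B)"
    using assms(4) by (auto simp: disjoint_family_on_def binaryset_def)
  moreover have "range (binaryset A B) \<subseteq> sets M"
    using assms by (auto simp: range_binaryset_eq)
  ultimately have "(\<lambda>i. \<nu> (binaryset A B i)) sums \<nu> (\<Union>i. binaryset A B i)"
    using assms(1) unfolding signed_measure_def by blast
  then have "(\<lambda>i. \<nu> (binaryset A B i)) sums \<nu> (A \<union> B)"
    by (simp add: UN_binaryset_eq)
  then show ?thesis
    using binaryset_sums[of \<nu> A B] signed_measure_empty[OF assms(1)] sums_unique2 by blast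
qed

lemma signed_measure_uminus:
  assumes "signed_measure M \<nu>"
  shows "signed_measure M (\<lambda>A. - \<nu> A)"
  using assms unfolding signed_measure_def by (auto intro: sums_minus)

lemma tv_norm_uminus: "tv_norm M (\<lambda>A. - \<nu> A) = tv_norm M \<nu>"
  by (simp add: tv_norm_def)

text \<open>
  The set and its complement form a partition, one of those over which the total variation takes
  its supremum; an empty one of the two has to be dropped.
\<close>

lemma ennreal_le_tv_norm:
  assumes "signed_measure M \<nu>" "B \<in> sets M"
  shows "ennreal (\<nu> B) \<le> tv_norm M \<nu>"
proof -
  define P where "P = {B, space M - B} - {{}}"
  have B: "B \<subseteq> space M"
    using assms(2) by (rule sets.sets_into_space)
  have "P \<in> {P. finite P \<and> P \<subseteq> sets M \<and> partition_on (space M) P}"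
    using assms(2) B by (auto simp: P_def partition_on_def disjoint_def)
  then have "(\<Sum>A\<in>P. ennreal \<bar>\<nu> A\<bar>) \<le> tv_norm M \<nu>"
    unfolding tv_norm_def by (rule SUP_upper)
  moreover have "ennreal (\<nu> B) \<le> (\<Sum>A\<in>P. ennreal \<bar>\<nu> A\<bar>)"
  proof (cases "B = {}")
    case True
    then show ?thesis
      using signed_measure_empty[OF assms(1)] by simp
  next
    case False
    then have "B \<in> P" "finite P" by (auto simp: P_def)
    then have "ennreal \<bar>\<nu> B\<bar> \<le> (\<Sum>A\<in>P. ennreal \<bar>\<nu> A\<bar>)"
      by (intro member_le_sum) auto
    then show ?thesis
      by (rule order_trans[rotated]) (auto intro: ennreal_leI)
  qed
  ultimately show ?thesis by (rule order_trans[rotated])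
qed

text \<open>
  The set function underlying \<^const>\<open>pos_part\<close>. That it is a measure has to be shown, since
  \<^const>\<open>measure_of\<close> is the zero measure otherwise.
\<close>

definition upper_variation :: "'a measure \<Rightarrow> ('a set \<Rightarrow> real) \<Rightarrow> 'a set \<Rightarrow> ennreal" where
  "upper_variation M \<nu> A = (SUP B \<in> {B \<in> sets M. B \<subseteq> A}. ennreal (\<nu> B))"

text \<open>
  Near-optimal subsets of \<open>A\<close> and of \<open>B\<close> are disjoint, so their union competes in the supremum for
  \<open>A \<union> B\<close>. A subset of negative measure contributes \<open>0\<close> and can be dropped.
\<close>

lemma upper_variation_superadditive:
  assumes \<nu>: "signed_measure M \<nu>" and "A \<inter> B = {}"
  shows "upper_variation M \<nu> A + upper_variation M \<nu> B \<le> upper_variation M \<nu> (A \<union> B)"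
proof -
  have ne: "{C \<in> sets M. C \<subseteq> X} \<noteq> {}" for X
    by (auto intro!: exI[of _ "{}"])
  have "ennreal (\<nu> C) + ennreal (\<nu> D) \<le> upper_variation M \<nu> (A \<union> B)"
    if C: "C \<in> sets M" "C \<subseteq> A" and D: "D \<in> sets M" "D \<subseteq> B" for C D
  proof -
    have up: "ennreal (\<nu> E) \<le> upper_variation M \<nu> (A \<union> B)" if "E \<in> sets M" "E \<subseteq> A \<union> B" for E
      unfolding upper_variation_def using that by (intro SUP_upper) auto
    show ?thesis
    proof (cases "0 \<le> \<nu> C \<and> 0 \<le> \<nu> D")
      case True
      have "\<nu> (C \<union> D) = \<nu> C + \<nu> D"
        using C D assms(2) by (intro signed_measure_Un[OF \<nu>]) auto
      then have "ennreal (\<nu> C) + ennreal (\<nu> D) = ennreal (\<nu> (C \<union> D))"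
        using True by simp
      moreover have "C \<union> D \<in> sets M" "C \<union> D \<subseteq> A \<union> B"
        using C D by auto
      ultimately show ?thesis
        using up by simp
    next
      case False
      then have "ennreal (\<nu> C) = 0 \<or> ennreal (\<nu> D) = 0"
        by (auto simp: ennreal_neg)
      then show ?thesis
        using up[OF C(1)] up[OF D(1)] C D by (auto simp: le_supI1 le_supI2)
    qed
  qed
  then have "upper_variation M \<nu> A + ennreal (\<nu> D) \<le> upper_variation M \<nu> (A \<union> B)"
    if "D \<in> sets M" "D \<subseteq> B" for D
    unfolding upper_variation_def[of _ _ A] ennreal_SUP_add_left[OF ne, symmetric]
    using that by (intro SUP_least) auto
  then have "(SUP D\<in>{D \<in> sets M. D \<subseteq> B}. upper_variation M \<nu> A + ennreal (\<nu> D))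
      \<le> upper_variation M \<nu> (A \<union> B)"
    by (intro SUP_least) auto
  then show ?thesis
    unfolding upper_variation_def[of _ _ B] by (simp only: ennreal_SUP_add_right[OF ne])
qed

text \<open>
  A competitor \<open>B\<close> for the union is cut into the pieces \<open>B \<inter> A i\<close>. Their measures may have either
  sign, so the comparison with the series in \<^typ>\<open>ennreal\<close> is made for partial sums.
\<close>

lemma upper_variation_subadditive:
  assumes \<nu>: "signed_measure M \<nu>" and A: "range A \<subseteq> sets M" "disjoint_family A"
  shows "upper_variation M \<nu> (\<Union>i. A i) \<le> (\<Sum>i::nat. upper_variation M \<nu> (A i))"
  unfolding upper_variation_def[of _ _ "\<Union>i. A i"]
proof (rule SUP_least)
  fix B assume "B \<in> {B \<in> sets M. B \<subseteq> (\<Union>i. A i)}"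
  then have B: "B \<in> sets M" "(\<Union>i. B \<inter> A i) = B" by auto
  have "range (\<lambda>i. B \<inter> A i) \<subseteq> sets M" "disjoint_family (\<lambda>i. B \<inter> A i)"
    using A B by (auto simp: disjoint_family_on_def)
  with \<nu> have "(\<lambda>i. \<nu> (B \<inter> A i)) sums \<nu> B"
    unfolding signed_measure_def using B(2) by metis
  then have lim: "(\<lambda>n. ennreal (\<Sum>i<n. \<nu> (B \<inter> A i))) \<longlonglongrightarrow> ennreal (\<nu> B)"
    by (intro tendsto_ennrealI) (simp add: sums_def)
  have "ennreal (\<Sum>i<n. \<nu> (B \<inter> A i)) \<le> (\<Sum>i. upper_variation M \<nu> (A i))" for n
  proof -
    have "ennreal (\<Sum>i<n. \<nu> (B \<inter> A i)) \<le> (\<Sum>i<n. ennreal (\<nu> (B \<inter> A i)))"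
    proof (induction n)
      case (Suc n)
      have "ennreal (a + b) \<le> ennreal a + ennreal b" for a b :: real
        by (cases "0 \<le> a"; cases "0 \<le> b") (auto simp: ennreal_neg intro: ennreal_leI)
      from order_trans[OF this add_right_mono[OF Suc]] show ?case
        by simp
    qed simp
    also have "\<dots> \<le> (\<Sum>i<n. upper_variation M \<nu> (A i))"
      unfolding upper_variation_def using A B(1) by (intro sum_mono SUP_upper) auto
    also have "\<dots> \<le> (\<Sum>i. upper_variation M \<nu> (A i))"
      by (intro sum_le_suminf) auto
    finally show ?thesis .
  qed
  then show "ennreal (\<nu> B) \<le> (\<Sum>i. upper_variation M \<nu> (A i))"
    using lim by (intro LIMSEQ_le_const2[OF lim]) auto
qed

lemma countably_additive_upper_variation:
  assumes \<nu>: "signed_measure M \<nu>"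
  shows "countably_additive (sets M) (upper_variation M \<nu>)"
proof (rule countably_additiveI)
  fix A :: "nat \<Rightarrow> 'a set"
  assume A: "range A \<subseteq> sets M" "disjoint_family A"
  have "(\<Sum>i<n. upper_variation M \<nu> (A i)) \<le> upper_variation M \<nu> (\<Union>i<n. A i)" for n
  proof (induction n)
    case (Suc n)
    have "A i \<inter> A n = {}" if "i < n" for i
      using A(2) that by (simp add: disjoint_family_on_def)
    then have disj: "(\<Union>i<n. A i) \<inter> A n = {}"
      by blast
    have "(\<Sum>i<Suc n. upper_variation M \<nu> (A i))
        \<le> upper_variation M \<nu> (\<Union>i<n. A i) + upper_variation M \<nu> (A n)"
      using Suc by (simp add: add_right_mono)
    also have "\<dots> \<le> upper_variation M \<nu> ((\<Union>i<n. A i) \<union> A n)"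
      by (rule upper_variation_superadditive[OF \<nu> disj])
    also have "(\<Union>i<n. A i) \<union> A n = (\<Union>i<Suc n. A i)"
      by (auto simp: lessThan_Suc)
    finally show ?case .
  qed simp
  moreover have "upper_variation M \<nu> (\<Union>i<n. A i) \<le> upper_variation M \<nu> (\<Union>i. A i)" for n
    unfolding upper_variation_def by (intro SUP_subset_mono) auto
  ultimately have "(\<Sum>i<n. upper_variation M \<nu> (A i)) \<le> upper_variation M \<nu> (\<Union>i. A i)" for n
    by (rule order_trans)
  then have "(\<Sum>i. upper_variation M \<nu> (A i)) \<le> upper_variation M \<nu> (\<Union>i. A i)"
    by (intro suminf_le_const) auto
  then show "(\<Sum>i. upper_variation M \<nu> (A i)) = upper_variation M \<nu> (\<Union>i. A i)"
    using upper_variation_subadditive[OF \<nu> A] by (rule antisym)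
qed

lemma sets_pos_part [measurable_cong]: "sets (pos_part M \<nu>) = sets M"
  by (simp add: pos_part_def sets.sigma_sets_eq sets.space_closed)

lemma space_pos_part: "space (pos_part M \<nu>) = space M"
  by (rule sets_eq_imp_space_eq[OF sets_pos_part])

lemma emeasure_pos_part:
  assumes \<nu>: "signed_measure M \<nu>" and "A \<in> sets M"
  shows "emeasure (pos_part M \<nu>) A = upper_variation M \<nu> A"
proof (rule emeasure_measure_of[of _ "space M" "sets M"])
  show "pos_part M \<nu> = measure_of (space M) (sets M) (upper_variation M \<nu>)"
    unfolding pos_part_def upper_variation_def ..
  show "positive (sets (pos_part M \<nu>)) (upper_variation M \<nu>)"
  proof -
    have "{B \<in> sets M. B \<subseteq> {}} = {{}}" by auto
    then show ?thesis
      using signed_measure_empty[OF \<nu>] by (simp add: positive_def upper_variation_def)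
  qed
  show "countably_additive (sets (pos_part M \<nu>)) (upper_variation M \<nu>)"
    using countably_additive_upper_variation[OF \<nu>] by (simp add: sets_pos_part)
qed (use assms in \<open>simp_all add: sets_pos_part sets.space_closed\<close>)

lemma emeasure_pos_part_le:
  assumes \<nu>: "signed_measure M \<nu>"
  shows "emeasure (pos_part M \<nu>) (space M) \<le> tv_norm M \<nu>"
  unfolding emeasure_pos_part[OF \<nu> sets.top] upper_variation_def
  by (rule SUP_least) (simp add: ennreal_le_tv_norm[OF \<nu>])

lemma continuous_on_interval_bounded:
  fixes z :: "real \<Rightarrow> real"
  assumes "continuous_on {a..b} z"
  obtains C where "C > 0" "\<And>r. r \<in> {a..b} \<Longrightarrow> \<bar>z r\<bar> \<le> C"
proof -
  have "bounded (z ` {a..b})"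
    using assms by (intro compact_imp_bounded compact_continuous_image) auto
  then show ?thesis
    using that unfolding bounded_pos by auto
qed

lemma pos_part_integral:
  assumes \<nu>: "signed_measure delay_space \<nu>" "tv_norm delay_space \<nu> \<le> ennreal K" and "0 \<le> K"
    and f: "continuous_on {-1..0} f"
  shows "integrable (pos_part delay_space \<nu>) f"
    and "(\<And>s. s \<in> {-1..0} \<Longrightarrow> \<bar>f s\<bar> \<le> C) \<Longrightarrow> \<bar>LINT s|pos_part delay_space \<nu>. f s\<bar> \<le> K * C"
proof -
  let ?P = "pos_part delay_space \<nu>"
  have space: "space ?P = {-1..0}"
    by (simp add: space_pos_part space_restrict_space)
  have em: "emeasure ?P (space ?P) \<le> ennreal K"
    using emeasure_pos_part_le[OF \<nu>(1)] \<nu>(2) by (simp add: space_pos_part)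
  then interpret P: finite_measure ?P
    by (intro finite_measureI) (auto simp: top_unique)
  have "f \<in> borel_measurable delay_space"
    using borel_measurable_continuous_on_restrict[OF f] by simp
  then have meas: "f \<in> borel_measurable ?P"
    by (simp add: measurable_cong_sets[OF sets_pos_part refl])
  obtain B where B: "\<And>s. s \<in> {-1..0} \<Longrightarrow> \<bar>f s\<bar> \<le> B"
    using continuous_on_interval_bounded[OF f] by blast
  show int: "integrable ?P f"
    by (rule P.integrable_const_bound[of _ B]) (use B meas space in auto)
  assume C: "\<And>s. s \<in> {-1..0} \<Longrightarrow> \<bar>f s\<bar> \<le> C"
  have "0 \<le> C" using C[of 0] by simp
  have "\<bar>LINT s|?P. f s\<bar> \<le> (LINT s|?P. \<bar>f s\<bar>)"
    by (rule integral_abs_bound)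
  also have "\<dots> \<le> (LINT s|?P. C)"
    using C space int by (intro integral_mono) auto
  also have "\<dots> = measure ?P (space ?P) * C" by simp
  also have "\<dots> \<le> K * C"
    using em \<open>0 \<le> C\<close> \<open>0 \<le> K\<close> by (intro mult_right_mono) (auto simp: P.emeasure_eq_measure)
  finally show "\<bar>LINT s|?P. f s\<bar> \<le> K * C" .
qed

lemma signed_integral_diff:
  assumes "\<nu> \<in> meas_ball K" "0 \<le> K" "continuous_on {-1..0} f" "continuous_on {-1..0} g"
  shows "signed_integral delay_space \<nu> (\<lambda>s. f s - g s) =
    signed_integral delay_space \<nu> f - signed_integral delay_space \<nu> g"
proof -
  have \<nu>: "signed_measure delay_space \<nu>" "tv_norm delay_space \<nu> \<le> ennreal K"
    using assms(1) by (auto simp: meas_ball_def)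
  have \<nu>': "signed_measure delay_space (\<lambda>A. - \<nu> A)" "tv_norm delay_space (\<lambda>A. - \<nu> A) \<le> ennreal K"
    using \<nu> by (auto simp: tv_norm_uminus intro: signed_measure_uminus)
  note int = pos_part_integral(1)[OF \<nu> assms(2)] pos_part_integral(1)[OF \<nu>' assms(2)]
  show ?thesis
    unfolding signed_integral_def neg_part_def
    by (simp add: int assms(3,4))
qed

text \<open>
  Each of the two parts has total mass at most \<open>K\<close>, and adding the two bounds gives the constant
  \<open>2 * K\<close>. The sharp constant is \<open>K\<close>; any bound that is uniform on the ball suffices for the
  continuity statement.
\<close>

lemma signed_integral_bound:
  assumes "\<nu> \<in> meas_ball K" "0 \<le> K" "continuous_on {-1..0} f"
    and "\<And>s. s \<in> {-1..0} \<Longrightarrow> \<bar>f s\<bar> \<le> C"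
  shows "\<bar>signed_integral delay_space \<nu> f\<bar> \<le> (2 * K) * C"
proof -
  have \<nu>: "signed_measure delay_space \<nu>" "tv_norm delay_space \<nu> \<le> ennreal K"
    using assms(1) by (auto simp: meas_ball_def)
  have \<nu>': "signed_measure delay_space (\<lambda>A. - \<nu> A)" "tv_norm delay_space (\<lambda>A. - \<nu> A) \<le> ennreal K"
    using \<nu> by (auto simp: tv_norm_uminus intro: signed_measure_uminus)
  from pos_part_integral(2)[OF \<nu> assms(2,3), of C] pos_part_integral(2)[OF \<nu>' assms(2,3), of C] assms(4)
  show ?thesis
    unfolding signed_integral_def neg_part_def by (simp add: algebra_simps abs_le_iff)
qed

section \<open>Absolutely continuous functions and their norm\<close>

text \<open>
  After a shift of the integration variable the integral telescopes to
  \<open>\<integral>\<^sub>b\<^sup>b\<^sup>+\<^sup>h W - \<integral>\<^sub>a\<^sup>a\<^sup>+\<^sup>h W\<close>, and both integrals are estimated by monotonicity.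
\<close>

lemma integral_forward_difference_le:
  fixes W :: "real \<Rightarrow> real"
  assumes "a \<le> b" "0 \<le> h" and W: "continuous_on UNIV W" "mono W"
  shows "integral {a..b} (\<lambda>t. W (t + h) - W t) \<le> h * (W (b + h) - W a)"
proof -
  have int: "W integrable_on {x..y}" for x y
    using W(1) by (intro integrable_continuous_interval) (auto intro: continuous_on_subset)
  have shift: "integral {a..b} (\<lambda>t. W (t + h)) = integral {a+h..b+h} W"
    "(\<lambda>t. W (t + h)) integrable_on {a..b}"
    using integral_shift_real_ivl[of "a+h" h "b+h" W] integrable_shift_real_ivl[OF int[of "a+h" "b+h"], of h] by auto
  have "integral {a..b} (\<lambda>t. W (t + h) - W t) = integral {a+h..b+h} W - integral {a..b} W"
    using shift by (simp add: integral_diff int)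
  also have "\<dots> = integral {b..b+h} W - integral {a..a+h} W"
    using Henstock_Kurzweil_Integration.integral_combine[of a "a+h" "b+h" W]
      Henstock_Kurzweil_Integration.integral_combine[of a b "b+h" W] assms int by simp
  finally have "integral {a..b} (\<lambda>t. W (t + h) - W t) = integral {b..b+h} W - integral {a..a+h} W" .
  moreover have "integral {b..b+h} W \<le> integral {b..b+h} (\<lambda>t. W (b + h))"
    using W(2) by (intro integral_le int) (auto simp: mono_def)
  moreover have "integral {a..a+h} (\<lambda>t. W a) \<le> integral {a..a+h} W"
    using W(2) by (intro integral_le int) (auto simp: mono_def)
  ultimately show ?thesis
    using assms(2) by (simp add: algebra_simps)
qed

text \<open>
  The absolute values \<open>Q k\<close> of the difference quotients with step \<open>1 / (k + 1)\<close> converge to \<open>\<bar>u'\<bar>\<close>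
  wherever \<open>u\<close> is differentiable. Their integrals are at most those of the quotients of \<open>V\<close>, hence at most
  \<open>V b - V a\<close> by \<open>integral_forward_difference_le\<close>, and Fatou's lemma carries the bound to
  \<open>\<integral> \<bar>u'\<bar>\<close>. When \<open>V\<close> is the indefinite integral of some \<open>\<bar>g\<bar>\<close>, this bounds the norm of an indefinite
  integral of \<open>g\<close> by the \<open>L\<^sup>1\<close> norm of \<open>g\<close>.
\<close>

lemma AC_norm_le:
  assumes ab: "a < b" and V: "continuous_on {a..b} V"
    and maj: "\<And>x y. a \<le> x \<Longrightarrow> x \<le> y \<Longrightarrow> y \<le> b \<Longrightarrow> \<bar>u y - u x\<bar> \<le> V y - V x"
  shows "AC_norm a b u \<le> \<bar>u a\<bar> + (V b - V a)"
proof -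
  \<comment> \<open>Beyond \<open>b\<close> the functions are continued as constants, so that forward quotients make sense up to \<open>b\<close>.\<close>
  define c where "c r = max a (min b r)" for r
  have c: "a \<le> c r" "c r \<le> b" "r \<le> s \<Longrightarrow> c r \<le> c s" "a \<le> r \<Longrightarrow> r \<le> b \<Longrightarrow> c r = r" for r s
    using ab by (auto simp: c_def)
  have c_cont: "continuous_on S c" for S
    unfolding c_def by (intro continuous_intros)
  have u: "continuous_on {a..b} u"
    unfolding continuous_on_iff
  proof (intro ballI allI impI)
    fix x e :: real assume x: "x \<in> {a..b}" and "0 < e"
    with V obtain d where d: "d > 0" "\<And>y. y \<in> {a..b} \<Longrightarrow> dist y x < d \<Longrightarrow> dist (V y) (V x) < e"
      unfolding continuous_on_iff by metis
    have "dist (u y) (u x) \<le> dist (V y) (V x)" if "y \<in> {a..b}" for y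
      using maj[of x y] maj[of y x] that x unfolding dist_real_def by (cases "x \<le> y") auto
    with d show "\<exists>d>0. \<forall>y\<in>{a..b}. dist y x < d \<longrightarrow> dist (u y) (u x) < e"
      by (meson le_less_trans)
  qed
  define U W where "U r = u (c r)" and "W r = V (c r)" for r
  have U: "continuous_on UNIV U" and W: "continuous_on UNIV W"
    unfolding U_def W_def using c
    by (auto intro!: continuous_on_compose2[OF u c_cont] continuous_on_compose2[OF V c_cont])
  have UW: "\<bar>U y - U x\<bar> \<le> W y - W x" if "x \<le> y" for x y
    unfolding U_def W_def using c that by (intro maj) auto
  have "mono W"
    by (rule monoI) (smt (verit) UW)
  define E where "E = {t \<in> {a<..<b}. u differentiable at t}"
  define Q where "Q k t = (if t \<in> {a..b} then \<bar>U (t + 1 / real (Suc k)) - U t\<bar> * real (Suc k) else 0)" for k t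
  have Q_meas: "Q k \<in> borel_measurable lebesgue" for k
  proof -
    have "continuous_on {a..b} (\<lambda>t. \<bar>U (t + 1 / real (Suc k)) - U t\<bar> * real (Suc k))"
      by (intro continuous_intros continuous_on_compose2[OF U]) auto
    then have "(\<lambda>t. \<bar>U (t + 1 / real (Suc k)) - U t\<bar> * real (Suc k)) \<in> borel_measurable (lebesgue_on {a..b})"
      by (intro continuous_imp_measurable_on_sets_lebesgue) auto
    then show ?thesis
      unfolding Q_def by (subst (asm) borel_measurable_if[symmetric]) auto
  qed
  have Q_int: "(\<integral>\<^sup>+t. ennreal (Q k t) \<partial>lebesgue) \<le> ennreal (V b - V a)" for k
  proof -
    let ?h = "1 / real (Suc k)"
    let ?g = "\<lambda>t. (W (t + ?h) - W t) * real (Suc k)"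
    have "(?g has_integral (integral {a..b} ?g)) {a..b}"
      by (intro integrable_integral integrable_continuous_interval continuous_intros
          continuous_on_compose2[OF W]) auto
    then have "integral\<^sup>N lborel (\<lambda>t. ennreal (?g t) * indicator {a..b} t) = ennreal (integral {a..b} ?g)"
      using \<open>mono W\<close> by (intro nn_integral_has_integral_lebesgue') (auto simp: mono_def)
    moreover have "integral\<^sup>N lborel (\<lambda>t. ennreal (?g t) * indicator {a..b} t) =
        (\<integral>\<^sup>+t. ennreal (?g t) * indicator {a..b} t \<partial>lebesgue)"
      by (rule nn_integral_completion[symmetric])
    moreover have "(\<integral>\<^sup>+t. ennreal (Q k t) \<partial>lebesgue) \<le> (\<integral>\<^sup>+t. ennreal (?g t) * indicator {a..b} t \<partial>lebesgue)"
      using UW by (intro nn_integral_mono) (auto simp: Q_def indicator_def intro!: ennreal_leI mult_right_mono)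
    moreover have "integral {a..b} ?g \<le> V b - V a"
    proof -
      have "integral {a..b} ?g = integral {a..b} (\<lambda>t. W (t + ?h) - W t) * real (Suc k)"
        by (rule integral_mult_left)
      also have "\<dots> \<le> (?h * (W (b + ?h) - W a)) * real (Suc k)"
        using ab \<open>mono W\<close> W by (intro mult_right_mono integral_forward_difference_le) auto
      also have "\<dots> = V b - V a"
        using ab by (simp add: W_def c_def)
      finally show ?thesis .
    qed
    ultimately show ?thesis by (metis ennreal_leI order_trans)
  qed
  have lim: "(\<lambda>k. Q k t) \<longlonglongrightarrow> \<bar>deriv u t\<bar>" if t: "t \<in> E" for t
  proof -
    have t': "a < t" "t < b" and "(u has_real_derivative deriv u t) (at t)"
      using t by (auto simp: E_def DERIV_deriv_iff_real_differentiable)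
    then have "((\<lambda>h. (u (t + h) - u t) / h) \<longlongrightarrow> deriv u t) (at 0)"
      by (simp add: DERIV_def)
    moreover have h0: "(\<lambda>k. 1 / real (Suc k)) \<longlonglongrightarrow> 0"
      using LIMSEQ_inverse_real_of_nat by (simp add: inverse_eq_divide)
    then have "filterlim (\<lambda>k. 1 / real (Suc k)) (at 0) sequentially"
      by (intro filterlim_atI) auto
    ultimately have "(\<lambda>k. (u (t + 1 / real (Suc k)) - u t) / (1 / real (Suc k))) \<longlonglongrightarrow> deriv u t"
      by (rule filterlim_compose)
    then have "(\<lambda>k. \<bar>(u (t + 1 / real (Suc k)) - u t) * real (Suc k)\<bar>) \<longlonglongrightarrow> \<bar>deriv u t\<bar>"
      by (intro tendsto_rabs) simp
    moreover have "\<forall>\<^sub>F k in sequentially. 1 / real (Suc k) < b - t"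
      using h0 t' by (intro order_tendstoD) auto
    then have "\<forall>\<^sub>F k in sequentially. \<bar>(u (t + 1 / real (Suc k)) - u t) * real (Suc k)\<bar> = Q k t"
    proof eventually_elim
      case (elim k)
      have "c t = t" "c (t + 1 / real (Suc k)) = t + 1 / real (Suc k)"
        using t' elim by (auto intro!: c simp: add_nonneg_nonneg less_imp_le add_increasing2)
      then show ?case using t' by (simp add: Q_def U_def abs_mult)
    qed
    ultimately show ?thesis by (rule Lim_transform_eventually)
  qed
  let ?f = "\<lambda>t. indicator E t *\<^sub>R \<bar>deriv u t\<bar>"
  have "(LINT t|lebesgue. ?f t) \<le> V b - V a"
  proof (cases "integrable lebesgue ?f")
    case False
    \<comment> \<open>A Bochner integral is 0 by convention when the integrand is not integrable.\<close>
    then show ?thesis using maj[of a b] ab by (simp add: not_integrable_integral_eq)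
  next
    case True
    have "ennreal (LINT t|lebesgue. ?f t) = (\<integral>\<^sup>+t. ennreal (?f t) \<partial>lebesgue)"
      by (rule nn_integral_eq_integral[symmetric, OF True]) auto
    also have "\<dots> \<le> (\<integral>\<^sup>+t. liminf (\<lambda>k. ennreal (Q k t)) \<partial>lebesgue)"
    proof (rule nn_integral_mono)
      fix t show "ennreal (?f t) \<le> liminf (\<lambda>k. ennreal (Q k t))"
      proof (cases "t \<in> E")
        case True
        then have "liminf (\<lambda>k. ennreal (Q k t)) = ennreal \<bar>deriv u t\<bar>"
          by (intro lim_imp_Liminf tendsto_ennrealI lim) auto
        then show ?thesis using True by simp
      qed simp
    qed
    also have "\<dots> \<le> liminf (\<lambda>k. \<integral>\<^sup>+t. ennreal (Q k t) \<partial>lebesgue)"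
      using Q_meas by (intro nn_integral_liminf) measurable
    also have "\<dots> \<le> ennreal (V b - V a)"
      using Q_int by (intro Liminf_le) auto
    finally show ?thesis using maj[of a b] ab by (simp add: ennreal_le_iff)
  qed
  then show ?thesis
    by (simp add: AC_norm_def set_lebesgue_integral_def E_def)
qed

lemma AC_if_lipschitz:
  assumes "0 < C" and lip: "\<And>x y. a \<le> x \<Longrightarrow> x \<le> y \<Longrightarrow> y \<le> b \<Longrightarrow> \<bar>u y - u x\<bar> \<le> C * (y - x)"
  shows "u \<in> AC a b"
  unfolding AC_def mem_Collect_eq
proof (intro allI impI)
  fix \<epsilon> :: real assume "\<epsilon> > 0"
  show "\<exists>\<delta>>0. \<forall>(n::nat) (x::nat \<Rightarrow> real) (y::nat \<Rightarrow> real).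
      (\<forall>i<n. a \<le> x i \<and> x i \<le> y i \<and> y i \<le> b) \<longrightarrow>
      disjoint_family_on (\<lambda>i. {x i<..<y i}) {..<n} \<longrightarrow>
      (\<Sum>i<n. y i - x i) < \<delta> \<longrightarrow>
      (\<Sum>i<n. \<bar>u (y i) - u (x i)\<bar>) < \<epsilon>"
  proof (intro exI[of _ "\<epsilon> / C"] conjI allI impI)
    show "0 < \<epsilon> / C" using \<open>\<epsilon> > 0\<close> \<open>0 < C\<close> by simp
    fix n :: nat and x y :: "nat \<Rightarrow> real"
    assume xy: "\<forall>i<n. a \<le> x i \<and> x i \<le> y i \<and> y i \<le> b" and sum: "(\<Sum>i<n. y i - x i) < \<epsilon> / C"
    have "(\<Sum>i<n. \<bar>u (y i) - u (x i)\<bar>) \<le> (\<Sum>i<n. C * (y i - x i))"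
      using xy by (intro sum_mono lip) auto
    also have "\<dots> = C * (\<Sum>i<n. y i - x i)"
      by (simp add: sum_distrib_left)
    also have "\<dots> < \<epsilon>"
      using sum \<open>0 < C\<close> by (simp add: field_simps)
    finally show "(\<Sum>i<n. \<bar>u (y i) - u (x i)\<bar>) < \<epsilon>" .
  qed
qed

lemma AC_cong:
  assumes "u \<in> AC a b" and eq: "\<And>t. t \<in> {a..b} \<Longrightarrow> u t = v t"
  shows "v \<in> AC a b"
proof -
  have "(\<Sum>i<n. \<bar>v (y i) - v (x i)\<bar>) = (\<Sum>i<n. \<bar>u (y i) - u (x i)\<bar>)"
    if "\<forall>i<n. a \<le> x i \<and> x i \<le> y i \<and> y i \<le> b" for n :: nat and x y
  proof (rule sum.cong[OF refl])
    fix i assume "i \<in> {..<n}"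
    then have "a \<le> x i" "x i \<le> y i" "y i \<le> b" using that by auto
    then have "x i \<in> {a..b}" "y i \<in> {a..b}" by auto
    then show "\<bar>v (y i) - v (x i)\<bar> = \<bar>u (y i) - u (x i)\<bar>" by (simp add: eq)
  qed
  with assms(1) show ?thesis
    unfolding AC_def by (simp cong: imp_cong)
qed

text \<open>
  An interval \<open>(x, y)\<close> is cut at \<open>c\<close> into \<open>(min x c, min y c)\<close> and \<open>(max x c, max y c)\<close>, either of
  which may be empty. Each of the two families is again disjoint and no longer in total than the
  original one.
\<close>

lemma AC_concatenate:
  assumes "a \<le> c" "c \<le> b" and u: "u \<in> AC a c" "u \<in> AC c b"
  shows "u \<in> AC a b"
  unfolding AC_def mem_Collect_eq
proof (intro allI impI)
  fix \<epsilon> :: real assume "\<epsilon> > 0"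
  then have "\<epsilon> / 2 > 0" by simp
  obtain \<delta>1 where \<delta>1: "\<delta>1 > 0" "\<And>(n::nat) x y. (\<forall>i<n. a \<le> x i \<and> x i \<le> y i \<and> y i \<le> c) \<Longrightarrow>
      disjoint_family_on (\<lambda>i. {x i<..<y i}) {..<n} \<Longrightarrow> (\<Sum>i<n. y i - x i) < \<delta>1 \<Longrightarrow>
      (\<Sum>i<n. \<bar>u (y i) - u (x i)\<bar>) < \<epsilon> / 2"
    using u(1) \<open>\<epsilon> / 2 > 0\<close> unfolding AC_def by blast
  obtain \<delta>2 where \<delta>2: "\<delta>2 > 0" "\<And>(n::nat) x y. (\<forall>i<n. c \<le> x i \<and> x i \<le> y i \<and> y i \<le> b) \<Longrightarrow>
      disjoint_family_on (\<lambda>i. {x i<..<y i}) {..<n} \<Longrightarrow> (\<Sum>i<n. y i - x i) < \<delta>2 \<Longrightarrow>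
      (\<Sum>i<n. \<bar>u (y i) - u (x i)\<bar>) < \<epsilon> / 2"
    using u(2) \<open>\<epsilon> / 2 > 0\<close> unfolding AC_def by blast
  show "\<exists>\<delta>>0. \<forall>(n::nat) (x::nat \<Rightarrow> real) (y::nat \<Rightarrow> real).
      (\<forall>i<n. a \<le> x i \<and> x i \<le> y i \<and> y i \<le> b) \<longrightarrow>
      disjoint_family_on (\<lambda>i. {x i<..<y i}) {..<n} \<longrightarrow>
      (\<Sum>i<n. y i - x i) < \<delta> \<longrightarrow>
      (\<Sum>i<n. \<bar>u (y i) - u (x i)\<bar>) < \<epsilon>"
  proof (intro exI[of _ "min \<delta>1 \<delta>2"] conjI allI impI)
    show "0 < min \<delta>1 \<delta>2" using \<delta>1(1) \<delta>2(1) by simp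
    fix n :: nat and x y :: "nat \<Rightarrow> real"
    assume xy: "\<forall>i<n. a \<le> x i \<and> x i \<le> y i \<and> y i \<le> b"
      and disj: "disjoint_family_on (\<lambda>i. {x i<..<y i}) {..<n}"
      and sum: "(\<Sum>i<n. y i - x i) < min \<delta>1 \<delta>2"
    show "(\<Sum>i<n. \<bar>u (y i) - u (x i)\<bar>) < \<epsilon>"
    proof -
      let ?l = "\<lambda>r. min r c" and ?r = "\<lambda>r. max r c"
      have "{?l (x i)<..<?l (y i)} \<subseteq> {x i<..<y i}" "{?r (x i)<..<?r (y i)} \<subseteq> {x i<..<y i}" for i
        by auto
      then have disj': "disjoint_family_on (\<lambda>i. {?l (x i)<..<?l (y i)}) {..<n}"
          "disjoint_family_on (\<lambda>i. {?r (x i)<..<?r (y i)}) {..<n}"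
        using disj unfolding disjoint_family_on_def by blast+
      have "(\<Sum>i<n. ?l (y i) - ?l (x i)) \<le> (\<Sum>i<n. y i - x i)"
          "(\<Sum>i<n. ?r (y i) - ?r (x i)) \<le> (\<Sum>i<n. y i - x i)"
        using xy by (intro sum_mono; force)+
      then have sum': "(\<Sum>i<n. ?l (y i) - ?l (x i)) < \<delta>1" "(\<Sum>i<n. ?r (y i) - ?r (x i)) < \<delta>2"
        using sum by linarith+
      have "(\<Sum>i<n. \<bar>u (y i) - u (x i)\<bar>)
          \<le> (\<Sum>i<n. \<bar>u (?l (y i)) - u (?l (x i))\<bar> + \<bar>u (?r (y i)) - u (?r (x i))\<bar>)"
        using xy by (intro sum_mono) (auto simp: min_def max_def)
      also have "\<dots> = (\<Sum>i<n. \<bar>u (?l (y i)) - u (?l (x i))\<bar>) + (\<Sum>i<n. \<bar>u (?r (y i)) - u (?r (x i))\<bar>)"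
        by (rule sum.distrib)
      also have "(\<Sum>i<n. \<bar>u (?l (y i)) - u (?l (x i))\<bar>) < \<epsilon> / 2"
        using xy assms(1,2) by (intro \<delta>1(2) disj' sum') (auto simp: min_le_iff_disj)
      also have "(\<Sum>i<n. \<bar>u (?r (y i)) - u (?r (x i))\<bar>) < \<epsilon> / 2"
        using xy assms(1,2) by (intro \<delta>2(2) disj' sum') (auto simp: le_max_iff_disj)
      finally show ?thesis by simp
    qed
  qed
qed

section \<open>Linear delay equations\<close>

definition delay_rate :: "(real \<Rightarrow> (real \<Rightarrow> real) \<Rightarrow> real) \<Rightarrow> (real \<Rightarrow> real) \<Rightarrow> real \<Rightarrow> real" where
  "delay_rate L z t = L t (\<lambda>s. z (t + s))"

definition solves ::
  "real \<Rightarrow> (real \<Rightarrow> (real \<Rightarrow> real) \<Rightarrow> real) \<Rightarrow> (real \<Rightarrow> real) \<Rightarrow> (real \<Rightarrow> real) \<Rightarrow> bool" where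
  "solves T L u0 z \<longleftrightarrow> continuous_on {-1..T} z \<and> (\<forall>t\<in>{-1..0}. z t = u0 t) \<and>
     (\<forall>t\<in>{0..T}. z t = u0 0 + integral {0..t} (delay_rate L z))"

text \<open>
  What the equation sees of a bounded path of measures: \<open>L t f\<close> stands for the integral of \<open>f\<close>
  against the measure at time \<open>t\<close>, and \<open>M\<close> bounds its norm on \<open>C([-1, 0])\<close>.
\<close>

locale delay_functional =
  fixes T M :: real and L :: "real \<Rightarrow> (real \<Rightarrow> real) \<Rightarrow> real"
  assumes T_pos: "0 < T" and M_pos: "0 < M"
    and L_diff: "\<And>t f g. t \<in> {0..T} \<Longrightarrow> continuous_on {-1..0} f \<Longrightarrow> continuous_on {-1..0} g \<Longrightarrow>
      L t (\<lambda>s. f s - g s) = L t f - L t g"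
    and L_bound: "\<And>t f C. t \<in> {0..T} \<Longrightarrow> continuous_on {-1..0} f \<Longrightarrow>
      (\<And>s. s \<in> {-1..0} \<Longrightarrow> \<bar>f s\<bar> \<le> C) \<Longrightarrow> \<bar>L t f\<bar> \<le> M * C"
    and L_measurable: "\<And>f. continuous_on {-1..0} f \<Longrightarrow>
      (\<lambda>t. L t f) \<in> borel_measurable (lebesgue_on {0..T})"

lemma continuous_on_history:
  fixes z :: "real \<Rightarrow> real"
  assumes "continuous_on {-1..T} z" "t \<in> {0..T}"
  shows "continuous_on {-1..0} (\<lambda>s. z (t + s))"
  using assms(2) by (intro continuous_on_compose2[OF assms(1)] continuous_intros) auto

context delay_functional
begin

text \<open>
  The functional is defined on all functions on the reals, but sees only the values on
  \<open>[-1, 0]\<close>: the difference of \<open>f\<close> and \<open>g\<close> is bounded by \<open>0\<close> there.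
\<close>

lemma L_cong:
  assumes t: "t \<in> {0..T}" and f: "continuous_on {-1..0} f" and eq: "\<And>s. s \<in> {-1..0} \<Longrightarrow> f s = g s"
  shows "L t f = L t g"
proof -
  have g: "continuous_on {-1..0} g"
    using f eq continuous_on_cong[of "{-1..0}" "{-1..0}" f g] by auto
  have "\<bar>L t (\<lambda>s. f s - g s)\<bar> \<le> M * 0"
    using eq by (intro L_bound t continuous_intros f g) auto
  then show ?thesis
    using L_diff[OF t f g] by simp
qed

lemma delay_rate_diff:
  assumes "continuous_on {-1..T} z" "continuous_on {-1..T} y" "t \<in> {0..T}"
  shows "delay_rate L (\<lambda>r. z r - y r) t = delay_rate L z t - delay_rate L y t"
  unfolding delay_rate_def using assms by (intro L_diff continuous_on_history)

lemma delay_rate_bound: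
  assumes "continuous_on {-1..T} z" "t \<in> {0..T}" "\<And>r. r \<in> {-1..t} \<Longrightarrow> \<bar>z r\<bar> \<le> C"
  shows "\<bar>delay_rate L z t\<bar> \<le> M * C"
  unfolding delay_rate_def using assms by (intro L_bound continuous_on_history) auto

lemma delay_rate_cong:
  assumes "continuous_on {-1..T} z" "t \<in> {0..T}" "\<And>r. r \<in> {-1..T} \<Longrightarrow> z r = y r"
  shows "delay_rate L z t = delay_rate L y t"
  unfolding delay_rate_def using assms by (intro L_cong continuous_on_history) auto

text \<open>
  Here both the functional and its argument vary with \<open>t\<close>. Rounding the time shift to
  \<open>q k t = \<lfloor>(k + 1) t\<rfloor> / (k + 1)\<close> leaves countably many arguments, each of which gives a
  measurable function by assumption; as \<open>k\<close> grows, uniform continuity of \<open>z\<close> and the bound on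
  \<open>L t\<close> give pointwise convergence.
\<close>

lemma delay_rate_measurable:
  assumes z: "continuous_on {-1..T} z"
  shows "delay_rate L z \<in> borel_measurable (lebesgue_on {0..T})"
proof -
  \<comment> \<open>The rounded shift may be slightly out of range, so \<open>z\<close> is first extended to the reals.\<close>
  define c where "c r = max (-1) (min T r)" for r :: real
  have c: "c r \<in> {-1..T}" "\<bar>c r - c r'\<bar> \<le> \<bar>r - r'\<bar>" "r \<in> {-1..T} \<Longrightarrow> c r = r" for r r'
    using T_pos by (auto simp: c_def)
  define Z where "Z r = z (c r)" for r
  have c_cont: "continuous_on S (\<lambda>s. c (a + s))" for a S
    unfolding c_def by (intro continuous_intros)
  have cont: "continuous_on S (\<lambda>s. Z (a + s))" for a S
    unfolding Z_def using c(1) by (intro continuous_on_compose2[OF z c_cont]) auto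
  define q where "q k t = real_of_int \<lfloor>real (Suc k) * t\<rfloor> / real (Suc k)" for k t
  have q: "\<bar>q k t - t\<bar> \<le> 1 / real (Suc k)" for k t
  proof -
    have "\<bar>real_of_int \<lfloor>real (Suc k) * t\<rfloor> - real (Suc k) * t\<bar> \<le> 1" by linarith
    then have "\<bar>(real_of_int \<lfloor>real (Suc k) * t\<rfloor> - real (Suc k) * t) / real (Suc k)\<bar> \<le> 1 / real (Suc k)"
      by (simp add: divide_right_mono)
    then show ?thesis by (simp add: q_def diff_divide_distrib)
  qed
  show ?thesis
  proof (rule borel_measurable_LIMSEQ_metric)
    fix k
    have fl: "(\<lambda>t. \<lfloor>real (Suc k) * t\<rfloor>) \<in> measurable (lebesgue_on {0..T}) (count_space UNIV)"
    proof -
      have "(\<lambda>t::real. t) \<in> borel_measurable (lebesgue_on {0..T})"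
        by (intro continuous_imp_measurable_on_sets_lebesgue continuous_intros) auto
      then show ?thesis by measurable
    qed
    show "(\<lambda>t. L t (\<lambda>s. Z (q k t + s))) \<in> borel_measurable (lebesgue_on {0..T})"
      unfolding q_def
      by (rule measurable_compose_countable[OF _ fl, where f="\<lambda>i t. L t (\<lambda>s. Z (real_of_int i / real (Suc k) + s))"])
         (intro L_measurable cont)
  next
    fix t assume "t \<in> space (lebesgue_on {0..T})"
    then have t: "t \<in> {0..T}" by simp
    have "uniformly_continuous_on {-1..T} z"
      using z by (intro compact_uniformly_continuous) auto
    then have uc: "\<exists>\<delta>>0. \<forall>r r'. \<bar>r - r'\<bar> < \<delta> \<longrightarrow> \<bar>Z r - Z r'\<bar> < e" if "e > 0" for e
      using c that unfolding uniformly_continuous_on_def Z_def dist_real_def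
      by (meson le_less_trans)
    have eq: "delay_rate L z t = L t (\<lambda>s. Z (t + s))"
      unfolding delay_rate_def
    proof (rule sym, rule L_cong[OF t cont])
      show "Z (t + s) = z (t + s)" if "s \<in> {-1..0}" for s
        using that t c(3)[of "t + s"] by (simp add: Z_def)
    qed
    show "(\<lambda>k. L t (\<lambda>s. Z (q k t + s))) \<longlonglongrightarrow> delay_rate L z t"
    proof (rule LIMSEQ_I)
      fix e :: real assume "0 < e"
      then have "0 < e / (2 * M)" using M_pos by simp
      from uc[OF this] obtain \<delta> where \<delta>: "\<delta> > 0" "\<And>r r'. \<bar>r - r'\<bar> < \<delta> \<Longrightarrow> \<bar>Z r - Z r'\<bar> < e / (2 * M)"
        by blast
      from \<delta>(1) obtain N where N: "1 / real (Suc N) < \<delta>" using nat_approx_posE by blast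
      have "norm (L t (\<lambda>s. Z (q k t + s)) - delay_rate L z t) < e" if "N \<le> k" for k
      proof -
        have "1 / real (Suc k) \<le> 1 / real (Suc N)"
          using that by (simp add: frac_le)
        then have "\<bar>q k t - t\<bar> < \<delta>" using q[of k t] N by linarith
        then have "\<bar>L t (\<lambda>s. Z (q k t + s) - Z (t + s))\<bar> \<le> M * (e / (2 * M))"
          by (intro L_bound t continuous_intros cont less_imp_le[OF \<delta>(2)]) auto
        then show ?thesis
          using \<open>0 < e\<close> M_pos unfolding eq by (simp add: L_diff[OF t cont cont])
      qed
      then show "\<exists>N. \<forall>k\<ge>N. norm (L t (\<lambda>s. Z (q k t + s)) - delay_rate L z t) < e" by blast
    qed
  qed
qed

lemma delay_rate_abs_integrable:
  assumes z: "continuous_on {-1..T} z"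
  shows "delay_rate L z absolutely_integrable_on {0..T}"
proof -
  obtain C where C: "C > 0" "\<And>r. r \<in> {-1..T} \<Longrightarrow> \<bar>z r\<bar> \<le> C"
    using continuous_on_interval_bounded[OF z] by blast
  show ?thesis
  proof (rule measurable_bounded_by_integrable_imp_absolutely_integrable)
    show "(\<lambda>t. M * C) integrable_on {0..T}" by (rule integrable_const_ivl)
    show "norm (delay_rate L z t) \<le> M * C" if "t \<in> {0..T}" for t
      using delay_rate_bound[OF z that] C(2) that by auto
  qed (use delay_rate_measurable[OF z] in auto)
qed

lemma delay_rate_integrable:
  assumes z: "continuous_on {-1..T} z" and "t \<in> {0..T}"
  shows "delay_rate L z absolutely_integrable_on {0..t}" "delay_rate L z integrable_on {0..t}"
proof -
  show "delay_rate L z absolutely_integrable_on {0..t}"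
    using assms(2) by (intro set_integrable_subset[OF delay_rate_abs_integrable[OF z]]) auto
  then show "delay_rate L z integrable_on {0..t}"
    by (rule set_lebesgue_integral_eq_integral(1))
qed

text \<open>
  The function \<open>M S e\<^sup>2\<^sup>M\<^sup>\<tau>\<close> dominates the integrand and has the primitive \<open>S/2 e\<^sup>2\<^sup>M\<^sup>\<tau>\<close>. The weight
  \<open>2 M\<close> is chosen to make the factor \<open>1/2\<close>, whatever the length of the time interval.
\<close>

lemma delay_rate_integral_weighted:
  assumes d: "continuous_on {-1..T} d" and t: "t \<in> {0..T}"
    and S: "\<And>r. r \<in> {-1..T} \<Longrightarrow> \<bar>d r\<bar> \<le> S * exp (2 * M * r)"
  shows "\<bar>integral {0..t} (delay_rate L d)\<bar> \<le> S / 2 * exp (2 * M * t)"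
proof -
  have S0: "0 \<le> S" using S[of 0] T_pos abs_ge_zero[of "d 0"] by auto
  have "((\<lambda>x. M * (S * exp (2 * M * x))) has_integral
      (S / 2 * exp (2 * M * t) - S / 2 * exp (2 * M * 0))) {0..t}"
    using t M_pos
    by (intro fundamental_theorem_of_calculus)
       (auto intro!: derivative_eq_intros simp flip: has_real_derivative_iff_has_vector_derivative)
  then have int: "(\<lambda>x. M * (S * exp (2 * M * x))) integrable_on {0..t}"
      "integral {0..t} (\<lambda>x. M * (S * exp (2 * M * x))) \<le> S / 2 * exp (2 * M * t)"
    using S0 by (auto simp: has_integral_iff)
  have "norm (integral {0..t} (delay_rate L d)) \<le> integral {0..t} (\<lambda>x. M * (S * exp (2 * M * x)))"
  proof (rule integral_norm_bound_integral)
    fix x assume x: "x \<in> {0..t}"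
    have "\<bar>d r\<bar> \<le> S * exp (2 * M * x)" if "r \<in> {-1..x}" for r
    proof -
      have "\<bar>d r\<bar> \<le> S * exp (2 * M * r)" using that x t by (intro S) auto
      also have "\<dots> \<le> S * exp (2 * M * x)"
        using that S0 M_pos by (intro mult_left_mono) auto
      finally show ?thesis .
    qed
    then show "norm (delay_rate L d x) \<le> M * (S * exp (2 * M * x))"
      using delay_rate_bound[OF d, of x] x t by auto
  qed (use delay_rate_integrable[OF d t] int in auto)
  with int show ?thesis by simp
qed

text \<open>
  With \<open>S\<close> the maximum of \<open>e\<^sup>-\<^sup>2\<^sup>M\<^sup>r \<bar>d r\<bar>\<close>, the weighted estimate at a maximum point in
  \<open>[0, T]\<close> gives \<open>S \<le> \<epsilon> + S/2\<close>, hence \<open>S \<le> 2 \<epsilon>\<close>.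
\<close>

lemma perturbation_bound:
  assumes d: "continuous_on {-1..T} d" and d0: "\<And>r. r \<in> {-1..0} \<Longrightarrow> d r = 0"
    and eq: "\<And>t. t \<in> {0..T} \<Longrightarrow> \<bar>d t - integral {0..t} (delay_rate L d)\<bar> \<le> \<epsilon>"
    and r: "r \<in> {-1..T}"
  shows "\<bar>d r\<bar> \<le> 2 * exp (2 * M * T) * \<epsilon>"
proof -
  have \<epsilon>: "0 \<le> \<epsilon>" using eq[of 0] T_pos abs_ge_zero order_trans by fastforce
  have "\<exists>x\<in>{-1..T}. \<forall>y\<in>{-1..T}. exp (- 2 * M * y) * \<bar>d y\<bar> \<le> exp (- 2 * M * x) * \<bar>d x\<bar>"
    using T_pos by (intro continuous_attains_sup continuous_intros d) auto
  then obtain x where x: "x \<in> {-1..T}"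
    and max: "\<And>y. y \<in> {-1..T} \<Longrightarrow> exp (- 2 * M * y) * \<bar>d y\<bar> \<le> exp (- 2 * M * x) * \<bar>d x\<bar>"
    by blast
  define S where "S = exp (- 2 * M * x) * \<bar>d x\<bar>"
  have S: "\<bar>d y\<bar> \<le> S * exp (2 * M * y)" if "y \<in> {-1..T}" for y
  proof -
    have "\<bar>d y\<bar> = exp (- 2 * M * y) * \<bar>d y\<bar> * exp (2 * M * y)"
      by (simp add: exp_minus)
    also have "\<dots> \<le> S * exp (2 * M * y)"
      unfolding S_def by (intro mult_right_mono max that) auto
    finally show ?thesis .
  qed
  have "S \<le> 2 * \<epsilon>"
  proof (cases "x \<le> 0")
    case True
    then show ?thesis using d0[of x] x \<epsilon> by (simp add: S_def)
  next
    case False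
    then have x0: "x \<in> {0..T}" using x by auto
    have "\<bar>d x\<bar> \<le> \<epsilon> + S / 2 * exp (2 * M * x)"
      using eq[OF x0] delay_rate_integral_weighted[OF d x0 S] by linarith
    then have "exp (- 2 * M * x) * \<bar>d x\<bar> \<le> exp (- 2 * M * x) * (\<epsilon> + S / 2 * exp (2 * M * x))"
      by (intro mult_left_mono) auto
    also have "\<dots> = exp (- 2 * M * x) * \<epsilon> + S / 2"
      by (simp add: exp_minus field_simps)
    also have "exp (- 2 * M * x) * \<epsilon> \<le> \<epsilon>"
      using x0 M_pos \<epsilon> by (intro mult_left_le_one_le) auto
    finally show ?thesis unfolding S_def by simp
  qed
  then have "\<bar>d r\<bar> \<le> (2 * \<epsilon>) * exp (2 * M * T)"
    using S[OF r] r M_pos \<epsilon>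
    by (elim order_trans) (intro mult_mono, auto)
  then show ?thesis by (simp add: mult_ac)
qed

lemma solution_unique:
  assumes z: "solves T L u0 z" and y: "solves T L u0 y" and r: "r \<in> {-1..T}"
  shows "z r = y r"
proof -
  let ?d = "\<lambda>r. z r - y r"
  have zc: "continuous_on {-1..T} z" and yc: "continuous_on {-1..T} y"
    using z y by (auto simp: solves_def)
  have "?d t - integral {0..t} (delay_rate L ?d) = 0" if t: "t \<in> {0..T}" for t
  proof -
    have "integral {0..t} (delay_rate L ?d) = integral {0..t} (\<lambda>x. delay_rate L z x - delay_rate L y x)"
      using t by (intro integral_cong delay_rate_diff zc yc) auto
    also have "\<dots> = integral {0..t} (delay_rate L z) - integral {0..t} (delay_rate L y)"
      by (intro integral_diff delay_rate_integrable zc yc t)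
    finally show ?thesis using z y t by (auto simp: solves_def)
  qed
  then have "\<bar>?d r\<bar> \<le> 2 * exp (2 * M * T) * 0"
    using z y r by (intro perturbation_bound continuous_intros zc yc) (auto simp: solves_def)
  then show ?thesis by simp
qed

text \<open>
  Banach's fixed point theorem for \<open>w r = e\<^sup>-\<^sup>2\<^sup>M\<^sup>r z r\<close>, a substitution that turns the weighted norm
  into the plain supremum norm. The functions \<open>w\<close> live on the whole line, where bounded continuous
  functions form a complete space; the clamp \<open>c\<close> continues the value of the operator from
  \<open>[-1, T]\<close> by its boundary values.
\<close>

lemma solution_exists:
  assumes u0: "continuous_on {-1..0} u0"
  shows "\<exists>z. solves T L u0 z"
proof -
  define c where "c r = max (-1) (min T r)" for r :: real
  have c: "c r \<in> {-1..T}" "r \<in> {-1..T} \<Longrightarrow> c r = r" for r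
    using T_pos by (auto simp: c_def)
  have c_cont: "continuous_on S c" for S
    unfolding c_def by (intro continuous_intros)
  define P where "P z t = u0 (min t 0) + integral {0..max t 0} (delay_rate L z)" for z t
  have P_cont: "continuous_on {-1..T} (P z)" if z: "continuous_on {-1..T} z" for z
  proof -
    have "continuous_on {0..T} (\<lambda>t. integral {0..t} (delay_rate L z))"
      using delay_rate_integrable(2)[OF z, of T] T_pos by (intro indefinite_integral_continuous_1) auto
    then have "continuous_on {-1..T} (\<lambda>t. integral {0..max t 0} (delay_rate L z))"
      by (rule continuous_on_compose2) (use T_pos in \<open>auto intro!: continuous_on_max\<close>)
    moreover have "continuous_on {-1..T} (\<lambda>t. u0 (min t 0))"
      by (rule continuous_on_compose2[OF u0]) (auto intro!: continuous_on_min)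
    ultimately show ?thesis unfolding P_def by (intro continuous_intros)
  qed
  define W where "W w r = exp (2 * M * r) * apply_bcontfun w r" for w :: "real \<Rightarrow>\<^sub>C real" and r
  have W_cont: "continuous_on {-1..T} (W w)" for w
    unfolding W_def by (intro continuous_intros continuous_on_apply_bcontfun)
  define \<Psi> where "\<Psi> w = Bcontfun (\<lambda>r. exp (- (2 * M * c r)) * P (W w) (c r))" for w
  have \<Psi>: "apply_bcontfun (\<Psi> w) r = exp (- (2 * M * c r)) * P (W w) (c r)" for w r
  proof -
    have cont: "continuous_on {-1..T} (\<lambda>r. exp (- (2 * M * r)) * P (W w) r)"
      by (intro continuous_intros P_cont W_cont)
    obtain C where "\<And>r. r \<in> {-1..T} \<Longrightarrow> \<bar>exp (- (2 * M * r)) * P (W w) r\<bar> \<le> C"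
      using continuous_on_interval_bounded[OF cont] by blast
    moreover have "continuous_on UNIV (\<lambda>r. exp (- (2 * M * c r)) * P (W w) (c r))"
      using c by (intro continuous_on_compose2[OF cont c_cont]) auto
    ultimately have "(\<lambda>r. exp (- (2 * M * c r)) * P (W w) (c r)) \<in> bcontfun"
      using c(1) by (intro bcontfun_normI) auto
    then show ?thesis by (simp add: \<Psi>_def Bcontfun_inverse)
  qed
  have "dist (\<Psi> w) (\<Psi> v) \<le> 1/2 * dist w v" for w v
  proof (rule dist_bound)
    fix r :: real
    let ?d = "\<lambda>r. W w r - W v r"
    have d_cont: "continuous_on {-1..T} ?d" by (intro continuous_intros W_cont)
    have d: "\<bar>?d x\<bar> \<le> dist w v * exp (2 * M * x)" for x
    proof -
      have "\<bar>?d x\<bar> = exp (2 * M * x) * \<bar>apply_bcontfun w x - apply_bcontfun v x\<bar>"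
        unfolding W_def by (simp add: abs_mult flip: right_diff_distrib)
      also have "\<dots> \<le> exp (2 * M * x) * dist w v"
        using dist_bounded[of w x v] by (intro mult_left_mono) (auto simp: dist_real_def)
      finally show ?thesis by (simp add: mult.commute)
    qed
    define t where "t = max (c r) 0"
    have t: "t \<in> {0..T}" using c(1)[of r] T_pos by (auto simp: t_def)
    have diff: "P (W w) (c r) - P (W v) (c r) = integral {0..t} (delay_rate L ?d)"
    proof -
      have "integral {0..t} (delay_rate L ?d) = integral {0..t} (\<lambda>x. delay_rate L (W w) x - delay_rate L (W v) x)"
        using t by (intro integral_cong delay_rate_diff W_cont) auto
      also have "\<dots> = integral {0..t} (delay_rate L (W w)) - integral {0..t} (delay_rate L (W v))"
        by (intro integral_diff delay_rate_integrable W_cont t)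
      finally show ?thesis by (simp add: P_def t_def)
    qed
    show "dist (apply_bcontfun (\<Psi> w) r) (apply_bcontfun (\<Psi> v) r) \<le> 1/2 * dist w v"
    proof (cases "c r \<le> 0")
      case True
      then have "t = 0" by (simp add: t_def)
      then show ?thesis using diff by (simp add: \<Psi> dist_real_def)
    next
      case False
      then have ct: "c r = t" by (simp add: t_def)
      have "dist (apply_bcontfun (\<Psi> w) r) (apply_bcontfun (\<Psi> v) r)
          = exp (- (2 * M * t)) * \<bar>integral {0..t} (delay_rate L ?d)\<bar>"
        unfolding \<Psi> dist_real_def diff[symmetric] ct by (simp add: abs_mult flip: right_diff_distrib)
      also have "\<dots> \<le> exp (- (2 * M * t)) * (dist w v / 2 * exp (2 * M * t))"
        by (intro mult_left_mono delay_rate_integral_weighted[OF d_cont t d]) auto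
      also have "\<dots> = 1/2 * dist w v"
        by (simp add: exp_minus)
      finally show ?thesis .
    qed
  qed
  then have "\<exists>!w. \<Psi> w = w"
    by (intro banach_fix_type[of "1/2"]) auto
  then obtain w where w: "\<Psi> w = w" by blast
  have fix_eq: "W w r = P (W w) r" if "r \<in> {-1..T}" for r
    using arg_cong[OF w, of "\<lambda>w. apply_bcontfun w r"] c(2)[OF that]
    by (simp add: W_def \<Psi> exp_minus field_simps)
  have "solves T L u0 (W w)"
    unfolding solves_def using W_cont fix_eq T_pos by (auto simp: P_def)
  then show ?thesis by blast
qed

lemma solves_cong:
  assumes z: "solves T L u0 z" and eq: "\<And>r. r \<in> {-1..T} \<Longrightarrow> z r = y r"
  shows "solves T L u0 y"
proof -
  have zc: "continuous_on {-1..T} z" using z by (simp add: solves_def)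
  have "integral {0..t} (delay_rate L z) = integral {0..t} (delay_rate L y)" if "t \<in> {0..T}" for t
    using that by (intro integral_cong delay_rate_cong zc eq) auto
  moreover have "continuous_on {-1..T} y"
    using zc eq continuous_on_cong[of "{-1..T}" "{-1..T}" z y] by auto
  ultimately show ?thesis
    using z eq T_pos unfolding solves_def by auto
qed

lemma solution_increment:
  assumes z: "solves T L u0 z" and xy: "0 \<le> x" "x \<le> y" "y \<le> T"
  shows "z y - z x = integral {x..y} (delay_rate L z)"
proof -
  have "delay_rate L z integrable_on {0..y}"
    using z xy by (intro delay_rate_integrable) (auto simp: solves_def)
  then have "integral {0..y} (delay_rate L z) = integral {0..x} (delay_rate L z) + integral {x..y} (delay_rate L z)"
    using xy by (simp add: Henstock_Kurzweil_Integration.integral_combine)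
  then show ?thesis
    using z xy by (auto simp: solves_def)
qed

text \<open>
  Along a solution the right-hand side of the equation is bounded, so the solution is even
  Lipschitz continuous on \<open>[0, T]\<close>.
\<close>

lemma solution_AC:
  assumes z: "solves T L u0 z"
  shows "z \<in> AC 0 T"
proof -
  have zc: "continuous_on {-1..T} z" using z by (simp add: solves_def)
  obtain C where C: "C > 0" "\<And>r. r \<in> {-1..T} \<Longrightarrow> \<bar>z r\<bar> \<le> C"
    using continuous_on_interval_bounded[OF zc] by blast
  show ?thesis
  proof (rule AC_if_lipschitz)
    show "0 < M * C" using C(1) M_pos by simp
    fix x y assume xy: "0 \<le> x" "x \<le> y" "y \<le> T"
    have "delay_rate L z integrable_on {x..y}"
      using xy by (intro integrable_subinterval_real[OF delay_rate_integrable(2)[OF zc, of T]]) (use T_pos in auto)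
    then have "norm (integral {x..y} (delay_rate L z)) \<le> integral {x..y} (\<lambda>_. M * C)"
    proof (rule integral_norm_bound_integral)
      show "norm (delay_rate L z t) \<le> M * C" if "t \<in> {x..y}" for t
        using delay_rate_bound[OF zc, of t C] C(2) that xy by auto
    qed auto
    then show "\<bar>z y - z x\<bar> \<le> M * C * (y - x)"
      using solution_increment[OF z xy] xy by (simp add: mult_ac)
  qed
qed

lemma solution_AC_history:
  assumes z: "solves T L u0 z" and u0: "u0 \<in> AC (-1) 0"
  shows "z \<in> AC (-1) T"
proof (rule AC_concatenate)
  show "z \<in> AC 0 T" using z by (rule solution_AC)
  show "z \<in> AC (-1) 0"
  proof (rule AC_cong[OF u0])
    show "u0 t = z t" if "t \<in> {-1..0}" for t
      using z that by (simp add: solves_def)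
  qed
qed (use T_pos in auto)

end

section \<open>Dependence of the solution on the functional\<close>

text \<open>
  On \<open>[0, T]\<close> the difference \<open>d = z' - z\<close> is an indefinite integral of \<open>g\<close>, which differs from \<open>L' t (d (t + \<cdot>))\<close> by the perturbation
  \<open>h\<close>. The term with \<open>d\<close> is bounded by \<open>perturbation_bound\<close>, the other one contributes \<open>\<epsilon>\<close>.
  Writing \<open>u\<close> for a function that agrees with \<open>d\<close> only on \<open>[a, T]\<close> covers the restriction of the
  solutions to \<open>[0, T]\<close> as well as their full history.
\<close>

lemma solution_difference_bounds:
  assumes L: "delay_functional T M L" and L': "delay_functional T M L'"
    and z: "solves T L u0 z" and z': "solves T L' u0 z'"
  defines "\<epsilon> \<equiv> integral {0..T} (\<lambda>t. \<bar>delay_rate L' z t - delay_rate L z t\<bar>)"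
  assumes a: "a \<in> {-1..0}" and u: "\<And>r. r \<in> {a..T} \<Longrightarrow> u r = z' r - z r"
  shows "AC_norm a T u \<le> (1 + 2 * M * T * exp (2 * M * T)) * \<epsilon>"
proof -
  interpret L: delay_functional T M L by (rule L)
  interpret L': delay_functional T M L' by (rule L')
  have zc: "continuous_on {-1..T} z" and zc': "continuous_on {-1..T} z'"
    using z z' by (auto simp: solves_def)
  define d where "d r = z' r - z r" for r
  have dc: "continuous_on {-1..T} d"
    unfolding d_def by (intro continuous_intros zc zc')
  define h where "h t = delay_rate L' z t - delay_rate L z t" for t
  define g where "g t = delay_rate L' z' t - delay_rate L z t" for t
  have h: "h absolutely_integrable_on {0..T}" and g: "g absolutely_integrable_on {0..T}"
    unfolding h_def g_def
    by (intro set_integral_diff(1) L.delay_rate_abs_integrable L'.delay_rate_abs_integrable zc zc')+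
  have int: "h integrable_on {x..y}" "(\<lambda>t. \<bar>h t\<bar>) integrable_on {x..y}"
      "g integrable_on {x..y}" "(\<lambda>t. \<bar>g t\<bar>) integrable_on {x..y}" if "0 \<le> x" "y \<le> T" for x y
  proof -
    have "{x..y} \<subseteq> {0..T}" using that by auto
    then have "h absolutely_integrable_on {x..y}" "g absolutely_integrable_on {x..y}"
      using h g by (auto intro: set_integrable_subset)
    then show "h integrable_on {x..y}" "(\<lambda>t. \<bar>h t\<bar>) integrable_on {x..y}"
      "g integrable_on {x..y}" "(\<lambda>t. \<bar>g t\<bar>) integrable_on {x..y}"
      by (simp_all add: absolutely_integrable_on_def)
  qed
  have g_eq: "g t = delay_rate L' d t + h t" if "t \<in> {0..T}" for t
    unfolding g_def h_def d_def using L'.delay_rate_diff[OF zc' zc that] by simp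
  have d_bound: "\<bar>d r\<bar> \<le> 2 * exp (2 * M * T) * \<epsilon>" if "r \<in> {-1..T}" for r
  proof (rule L'.perturbation_bound[OF dc _ _ that])
    show "d r = 0" if "r \<in> {-1..0}" for r
      using z z' that by (simp add: solves_def d_def)
    fix t assume t: "t \<in> {0..T}"
    have "d t = integral {0..t} (delay_rate L' z') - integral {0..t} (delay_rate L z)"
      using z z' t by (simp add: solves_def d_def)
    also have "\<dots> = integral {0..t} g"
      unfolding g_def by (intro integral_diff[symmetric] L.delay_rate_integrable L'.delay_rate_integrable zc zc' t)
    also have "\<dots> = integral {0..t} (\<lambda>x. delay_rate L' d x + h x)"
      using t by (intro integral_cong g_eq) auto
    also have "\<dots> = integral {0..t} (delay_rate L' d) + integral {0..t} h"
      using t by (intro integral_add L'.delay_rate_integrable dc int) auto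
    finally have "\<bar>d t - integral {0..t} (delay_rate L' d)\<bar> = \<bar>integral {0..t} h\<bar>" by simp
    also have "\<dots> \<le> integral {0..t} (\<lambda>x. \<bar>h x\<bar>)"
      using t integral_norm_bound_integral[of h "{0..t}" "\<lambda>x. \<bar>h x\<bar>"] int[of 0 t] by simp
    also have "\<dots> \<le> \<epsilon>"
      unfolding \<epsilon>_def h_def[symmetric] using t
      by (intro integral_subset_le int) auto
    finally show "\<bar>d t - integral {0..t} (delay_rate L' d)\<bar> \<le> \<epsilon>" .
  qed
  \<comment> \<open>The truncation at 0 makes \<open>V\<close> vanish on \<open>[-1, 0]\<close>, as \<open>d\<close> does.\<close>
  define V where "V r = integral {0..max r 0} (\<lambda>t. \<bar>g t\<bar>)" for r
  have "AC_norm a T u \<le> \<bar>u a\<bar> + (V T - V a)"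
  proof (rule AC_norm_le)
    show "a < T" using a L.T_pos by auto
    have "continuous_on {0..T} (\<lambda>r. integral {0..r} (\<lambda>t. \<bar>g t\<bar>))"
      by (rule indefinite_integral_continuous_1) (simp add: int)
    then show "continuous_on {a..T} V"
      unfolding V_def by (rule continuous_on_compose2) (use L.T_pos in \<open>auto intro!: continuous_on_max\<close>)
    fix x y assume xy: "a \<le> x" "x \<le> y" "y \<le> T"
    let ?x = "max x 0" and ?y = "max y 0"
    have p: "0 \<le> ?x" "?x \<le> ?y" "?y \<le> T" using xy L.T_pos by auto
    have ext: "d r = d (max r 0)" if "r \<in> {-1..T}" for r
      using that z z' by (auto simp: solves_def d_def max_def)
    have "u y - u x = d y - d x"
      using u[of x] u[of y] xy by (simp add: d_def)
    also have "\<dots> = d ?y - d ?x"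
      using xy a ext[of x] ext[of y] by simp
    also have "\<dots> = integral {?x..?y} (delay_rate L' z') - integral {?x..?y} (delay_rate L z)"
      using L.solution_increment[OF z p] L'.solution_increment[OF z' p] by (simp add: d_def)
    also have "\<dots> = integral {?x..?y} g"
      unfolding g_def
    proof (rule integral_diff[symmetric])
      have xyT: "{?x..?y} \<subseteq> {0..T}" "T \<in> {0..T}" using p by auto
      show "delay_rate L' z' integrable_on {?x..?y}" "delay_rate L z integrable_on {?x..?y}"
        using integrable_subinterval_real[OF L.delay_rate_integrable(2)[OF zc xyT(2)] xyT(1)]
          integrable_subinterval_real[OF L'.delay_rate_integrable(2)[OF zc' xyT(2)] xyT(1)] by auto
    qed
    finally have "\<bar>u y - u x\<bar> \<le> integral {?x..?y} (\<lambda>t. \<bar>g t\<bar>)"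
      using integral_norm_bound_integral[of g "{?x..?y}" "\<lambda>x. \<bar>g x\<bar>"] int[OF p(1,3)]
      by simp
    also have "\<dots> = V y - V x"
      unfolding V_def using Henstock_Kurzweil_Integration.integral_combine[OF p(1,2) int(4)] p by simp
    finally show "\<bar>u y - u x\<bar> \<le> V y - V x" .
  qed
  also have "u a = 0"
    using u[of a] a z z' L.T_pos by (auto simp: solves_def)
  also have "V a = 0" using a by (simp add: V_def max_def)
  also have "V T = integral {0..T} (\<lambda>t. \<bar>g t\<bar>)" using L.T_pos by (simp add: V_def)
  also have "integral {0..T} (\<lambda>t. \<bar>g t\<bar>) \<le> integral {0..T} (\<lambda>t. M * (2 * exp (2 * M * T) * \<epsilon>) + \<bar>h t\<bar>)"
  proof (rule integral_le)
    fix t assume t: "t \<in> {0..T}"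
    have "\<bar>delay_rate L' d t\<bar> \<le> M * (2 * exp (2 * M * T) * \<epsilon>)"
      using t by (intro L'.delay_rate_bound dc d_bound) auto
    then show "\<bar>g t\<bar> \<le> M * (2 * exp (2 * M * T) * \<epsilon>) + \<bar>h t\<bar>"
      using g_eq[OF t] by linarith
  qed (auto intro!: int integrable_add)
  also have "\<dots> = T * (M * (2 * exp (2 * M * T) * \<epsilon>)) + \<epsilon>"
    using L.T_pos int[of 0 T] by (subst integral_add) (auto simp: \<epsilon>_def h_def)
  also have "\<dots> = (1 + 2 * M * T * exp (2 * M * T)) * \<epsilon>"
    by (simp add: algebra_simps)
  finally show ?thesis by simp
qed

text \<open>
  At almost every \<open>t\<close> the convergence assumption applies to the single continuous function
  \<open>s \<mapsto> z (t + s)\<close>; the integrands are bounded by \<open>2 * M * C\<close> with \<open>C\<close> a bound for \<open>z\<close>.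
\<close>

lemma delay_rate_L1_tendsto:
  assumes Ls: "\<And>n. delay_functional T M (Ls n)" and L: "delay_functional T M L"
    and conv: "AE t in lebesgue_on {0..T}. \<forall>f. continuous_on {-1..0} f \<longrightarrow> (\<lambda>n. Ls n t f) \<longlonglongrightarrow> L t f"
    and zc: "continuous_on {-1..T} z"
  shows "(\<lambda>n. integral {0..T} (\<lambda>t. \<bar>delay_rate (Ls n) z t - delay_rate L z t\<bar>)) \<longlonglongrightarrow> 0"
proof -
  interpret L: delay_functional T M L by (rule L)
  obtain C where C: "C > 0" "\<And>r. r \<in> {-1..T} \<Longrightarrow> \<bar>z r\<bar> \<le> C"
    using continuous_on_interval_bounded[OF zc] by blast
  define h where "h n t = \<bar>delay_rate (Ls n) z t - delay_rate L z t\<bar>" for n t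
  have meas: "h n \<in> borel_measurable (lebesgue_on {0..T})" for n
    unfolding h_def
    using delay_functional.delay_rate_measurable[OF Ls zc] L.delay_rate_measurable[OF zc]
    by (intro borel_measurable_abs borel_measurable_diff)
  have bound: "norm (h n t) \<le> 2 * M * C" if "t \<in> {0..T}" for n t
    using delay_functional.delay_rate_bound[OF Ls zc that, of C n] L.delay_rate_bound[OF zc that, of C] C(2) that
    unfolding h_def by fastforce
  have const: "integrable (lebesgue_on {0..T}) (\<lambda>t. 2 * M * C)"
    by (intro finite_measure.integrable_const finite_measure_lebesgue_on) auto
  have lim: "AE t in lebesgue_on {0..T}. (\<lambda>n. h n t) \<longlonglongrightarrow> 0"
    using conv AE_space
  proof eventually_elim
    case (elim t)
    then have "continuous_on {-1..0} (\<lambda>s. z (t + s))"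
      by (intro continuous_on_history[OF zc]) auto
    then have "(\<lambda>n. delay_rate (Ls n) z t) \<longlonglongrightarrow> delay_rate L z t"
      using elim by (simp add: delay_rate_def)
    then show ?case
      unfolding h_def by (intro tendsto_rabs_zero LIM_zero)
  qed
  have ae_bound: "AE t in lebesgue_on {0..T}. norm (h n t) \<le> 2 * M * C" for n
    using bound by (intro AE_I2) auto
  have "(\<lambda>n. integral\<^sup>L (lebesgue_on {0..T}) (h n)) \<longlonglongrightarrow> integral\<^sup>L (lebesgue_on {0..T}) (\<lambda>t. 0)"
    by (rule integral_dominated_convergence[OF _ meas const lim ae_bound]) auto
  moreover have "integral\<^sup>L (lebesgue_on {0..T}) (h n) = integral {0..T} (h n)" for n
    by (intro lebesgue_integral_eq_integral measurable_bounded_by_integrable_imp_lebesgue_integrable[OF meas const bound]) auto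
  ultimately have "(\<lambda>n. integral {0..T} (h n)) \<longlonglongrightarrow> 0" by simp
  then show ?thesis unfolding h_def .
qed

lemma AC_norm_solutions_tendsto:
  assumes Ls: "\<And>n. delay_functional T M (Ls n)" and L: "delay_functional T M L"
    and conv: "AE t in lebesgue_on {0..T}. \<forall>f. continuous_on {-1..0} f \<longrightarrow> (\<lambda>n. Ls n t f) \<longlonglongrightarrow> L t f"
    and zs: "\<And>n. solves T (Ls n) u0 (zs n)" and z: "solves T L u0 z"
    and a: "a \<in> {-1..0}" and us: "\<And>n r. r \<in> {a..T} \<Longrightarrow> us n r = zs n r - z r"
  shows "(\<lambda>n. AC_norm a T (us n)) \<longlonglongrightarrow> 0"
proof (rule tendsto_sandwich)
  let ?\<epsilon> = "\<lambda>n. integral {0..T} (\<lambda>t. \<bar>delay_rate (Ls n) z t - delay_rate L z t\<bar>)"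
  show "\<forall>\<^sub>F n in sequentially. 0 \<le> AC_norm a T (us n)"
    by (auto simp: AC_norm_def set_lebesgue_integral_def intro!: always_eventually add_nonneg_nonneg integral_nonneg)
  show "\<forall>\<^sub>F n in sequentially. AC_norm a T (us n) \<le> (1 + 2 * M * T * exp (2 * M * T)) * ?\<epsilon> n"
    by (intro always_eventually allI solution_difference_bounds[OF L Ls z zs a us])
  have "continuous_on {-1..T} z" using z by (simp add: solves_def)
  from tendsto_mult_right_zero[OF delay_rate_L1_tendsto[OF Ls L conv this]]
  show "(\<lambda>n. (1 + 2 * M * T * exp (2 * M * T)) * ?\<epsilon> n) \<longlonglongrightarrow> 0" .
qed auto

section \<open>The delay equation driven by signed measures\<close>

lemma delay_functional_signed_integral:
  assumes "T > 0" "K > 0" "\<mu> \<in> meas_paths K T"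
  shows "delay_functional T (2 * K) (\<lambda>t. signed_integral delay_space (\<mu> t))"
proof
  show "0 < T" "0 < 2 * K" using assms by auto
  fix t and f :: "real \<Rightarrow> real" assume t: "t \<in> {0..T}" and f: "continuous_on {-1..0} f"
  then have ball: "\<mu> t \<in> meas_ball K" using assms(3) by (auto simp: meas_paths_def)
  show "signed_integral delay_space (\<mu> t) (\<lambda>s. f s - g s) =
      signed_integral delay_space (\<mu> t) f - signed_integral delay_space (\<mu> t) g"
    if "continuous_on {-1..0} g" for g
    using assms(2) by (intro signed_integral_diff[OF ball _ f that]) auto
  show "\<bar>signed_integral delay_space (\<mu> t) f\<bar> \<le> 2 * K * C"
    if "\<And>s. s \<in> {-1..0} \<Longrightarrow> \<bar>f s\<bar> \<le> C" for C
    using assms(2) by (intro signed_integral_bound[OF ball _ f that]) auto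
qed (use assms(3) in \<open>auto simp: meas_paths_def\<close>)

lemma (in delay_functional) is_solution_iff_solves:
  assumes "L = (\<lambda>t. signed_integral delay_space (\<mu> t))"
  shows "is_solution T \<mu> u0 z \<longleftrightarrow> solves T L u0 z"
proof -
  have "(LINT \<tau>:{0..t}|lebesgue. signed_integral delay_space (\<mu> \<tau>) (\<lambda>s. z (\<tau> + s)))
      = integral {0..t} (delay_rate L z)" if "continuous_on {-1..T} z" "t \<in> {0..T}" for t
    using set_lebesgue_integral_eq_integral(2)[OF delay_rate_integrable(1)[OF that]]
    by (simp add: delay_rate_def assms)
  then show ?thesis by (auto simp: is_solution_def solves_def)
qed

text \<open>
  The description operator in \<^const>\<open>sol\<close> is meaningful by existence and uniqueness; a solution
  becomes the unique one among all functions on the reals after restriction to \<open>[-1, T]\<close>.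
\<close>

lemma sol_solves:
  assumes "T > 0" "K > 0" "continuous_on {-1..0} u0" "\<mu> \<in> meas_paths K T"
  shows "solves T (\<lambda>t. signed_integral delay_space (\<mu> t)) u0 (sol T \<mu> u0)"
proof -
  let ?L = "\<lambda>t. signed_integral delay_space (\<mu> t)"
  interpret delay_functional T "2 * K" ?L
    using assms by (intro delay_functional_signed_integral)
  obtain z where z: "solves T ?L u0 z"
    using solution_exists[OF assms(3)] by blast
  have "\<exists>!z. z \<in> extensional {-1..T} \<and> is_solution T \<mu> u0 z"
  proof (rule ex1I[of _ "restrict z {-1..T}"])
    have "solves T ?L u0 (restrict z {-1..T})"
      by (rule solves_cong[OF z]) simp
    then show "restrict z {-1..T} \<in> extensional {-1..T} \<and> is_solution T \<mu> u0 (restrict z {-1..T})"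
      by (simp add: is_solution_iff_solves)
    fix y assume y: "y \<in> extensional {-1..T} \<and> is_solution T \<mu> u0 y"
    show "y = restrict z {-1..T}"
      by (rule extensionalityI[of _ "{-1..T}"])
         (use y solution_unique[OF _ z, of y] in \<open>auto simp: is_solution_iff_solves\<close>)
  qed
  then have "is_solution T \<mu> u0 (sol T \<mu> u0)"
    unfolding sol_def by (rule theI'[THEN conjunct2])
  then show ?thesis by (simp add: is_solution_iff_solves)
qed

theorem theorem3p3:
  fixes T K :: real and u0 :: "real \<Rightarrow> real"
  assumes "T > 0" and "K > 0" and "continuous_on {-1..0} u0"
  shows "seq_continuous_into_AC K T 0 T (\<lambda>\<mu>. restrict (sol T \<mu> u0) {0..T}) \<and>
         (u0 \<in> AC (-1) 0 \<longrightarrow> seq_continuous_into_AC K T (-1) T (\<lambda>\<mu>. sol T \<mu> u0))"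
proof -
  note functional = delay_functional_signed_integral[OF assms(1,2)]
  note solves = sol_solves[OF assms]
  have lim: "(\<lambda>n. AC_norm a T (us n)) \<longlonglongrightarrow> 0"
    if "\<And>n. \<mu>s n \<in> meas_paths K T" "\<mu> \<in> meas_paths K T" "meas_paths_tendsto T \<mu>s \<mu>" "a \<in> {-1..0}"
      "\<And>n r. r \<in> {a..T} \<Longrightarrow> us n r = sol T (\<mu>s n) u0 r - sol T \<mu> u0 r" for \<mu>s \<mu> a us
    using that(3) by (intro AC_norm_solutions_tendsto[OF functional[OF that(1)] functional[OF that(2)] _
          solves[OF that(1)] solves[OF that(2)] that(4,5)]) (simp_all add: meas_paths_tendsto_def)
  have AC: "restrict (sol T \<mu> u0) {0..T} \<in> AC 0 T" if "\<mu> \<in> meas_paths K T" for \<mu>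
    by (rule AC_cong[OF delay_functional.solution_AC[OF functional[OF that] solves[OF that]]]) simp
  have AC': "sol T \<mu> u0 \<in> AC (-1) T" if "\<mu> \<in> meas_paths K T" "u0 \<in> AC (-1) 0" for \<mu>
    by (rule delay_functional.solution_AC_history[OF functional[OF that(1)] solves[OF that(1)] that(2)])
  have "seq_continuous_into_AC K T 0 T (\<lambda>\<mu>. restrict (sol T \<mu> u0) {0..T})"
    unfolding seq_continuous_into_AC_def
  proof (intro conjI ballI allI impI AC)
    fix \<mu>s \<mu>
    assume "\<forall>n. \<mu>s n \<in> meas_paths K T" "\<mu> \<in> meas_paths K T" "meas_paths_tendsto T \<mu>s \<mu>"
    then show "(\<lambda>n. AC_norm 0 T (\<lambda>t. restrict (sol T (\<mu>s n) u0) {0..T} t - restrict (sol T \<mu> u0) {0..T} t)) \<longlonglongrightarrow> 0"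
      by (intro lim[of \<mu>s \<mu>]) auto
  qed
  moreover have "seq_continuous_into_AC K T (-1) T (\<lambda>\<mu>. sol T \<mu> u0)" if "u0 \<in> AC (-1) 0"
    unfolding seq_continuous_into_AC_def
  proof (intro conjI ballI allI impI AC' that)
    fix \<mu>s \<mu>
    assume "\<forall>n. \<mu>s n \<in> meas_paths K T" "\<mu> \<in> meas_paths K T" "meas_paths_tendsto T \<mu>s \<mu>"
    then show "(\<lambda>n. AC_norm (-1) T (\<lambda>t. sol T (\<mu>s n) u0 t - sol T \<mu> u0 t)) \<longlonglongrightarrow> 0"
      by (intro lim[of \<mu>s \<mu>]) auto
  qed
  ultimately show ?thesis by blast
qed

end
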